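(* Let $k,\ell\geq 1$ be integers. Then $$C(P_k,P_\ell)=\begin{cases}\frac{k}{\ell} & \text{if } k>\ell \text{ and either } k \text{ is even or both } k,\ell \text{ are odd},\\ \frac{k+1}{\ell} & \text{if } k \text{ is odd and } \ell \text{ is even},\\ \frac{k+1}{\ell+1} & \text{if } k<\ell \text{ and } k \text{ is even},\\ \frac{k+\ell-r}{(a+1)\ell} & \text{if } k<\ell \text{ and } k,\ell \text{ are both odd},\end{cases}$$ where in the last case $a=\lfloor \ell/(k+1)\rfloor$ and $r=\ell-a(k+1)$ is the remainder of the division of $\ell$ by $k+1$.
   Context: All graphs are finite and simple. $P_m$ denotes the path with $m$ edges. $\operatorname{hom}(H,T)$ is the number of maps $V(H)\to V(T)$ sending every edge of $H$ to an edge of $T$, $t(H,T)=\operatorname{hom}(H,T)/v(T)^{v(H)}$, and $C(G,H)=\min\{c\in\mathbb{R}: t(G,T)\geq t(H,T)^c \text{ for all graphs } T\}$. *)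

theory Defs
  imports "HOL-Analysis.Analysis" "Graph_Theory.Pair_Digraph"
begin

text \<open>
  A finite simple graph is a \<^locale>\<open>pair_graph\<close>: a finite vertex set with a symmetric,
  irreflexive set of arcs, each edge being represented by its two orientations.
\<close>

definition path_graph :: "nat \<Rightarrow> nat pair_pre_digraph" where
  "path_graph m =
    \<lparr> pverts = {0..m},
      parcs = {(i, j). i \<le> m \<and> j \<le> m \<and> (j = Suc i \<or> i = Suc j)} \<rparr>"

lemma pair_graph_path_graph: "pair_graph (path_graph m)"
proof
  have "parcs (path_graph m) \<subseteq> {0..m} \<times> {0..m}"
    by (auto simp: path_graph_def)
  then show "finite (parcs (path_graph m))"
    by (rule finite_subset) simp
  show "symmetric (path_graph m)"
    by (auto simp: path_graph_def symmetric_def sym_def)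
qed (auto simp: path_graph_def)

definition graph_homs :: "'a pair_pre_digraph \<Rightarrow> 'b pair_pre_digraph \<Rightarrow> ('a \<Rightarrow> 'b) set" where
  "graph_homs H T =
    {f \<in> pverts H \<rightarrow>\<^sub>E pverts T. \<forall>(u, v) \<in> parcs H. (f u, f v) \<in> parcs T}"

definition hom_count :: "'a pair_pre_digraph \<Rightarrow> 'b pair_pre_digraph \<Rightarrow> nat" where
  "hom_count H T = card (graph_homs H T)"

definition hom_density :: "'a pair_pre_digraph \<Rightarrow> 'b pair_pre_digraph \<Rightarrow> real" where
  "hom_density H T = real (hom_count H T) / real (card (pverts T)) ^ card (pverts H)"

text \<open>
  Every finite graph is isomorphic to one whose vertices are natural numbers, so it suffices to
  let the target range over these; it has to be nonempty for the densities to make sense.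
  The convention \<open>0 powr c = 0\<close> differs from the usual power only for \<open>c \<le> 0\<close>, and for paths
  with at least one edge no such \<open>c\<close> is admissible anyway: take a single edge as target, where both
  densities lie strictly between \<open>0\<close> and \<open>1\<close>.
\<close>

definition domination_exponents :: "'a pair_pre_digraph \<Rightarrow> 'b pair_pre_digraph \<Rightarrow> real set" where
  "domination_exponents G H =
    {c. \<forall>T :: nat pair_pre_digraph. pair_graph T \<and> pverts T \<noteq> {} \<longrightarrow>
          hom_density G T \<ge> hom_density H T powr c}"

text \<open>
  The assertion \<open>C(G, H) = c\<close>, as a relation because the minimum need not exist for
  arbitrary \<open>G\<close> and \<open>H\<close>.
\<close>

definition has_domination_exponent ::
    "'a pair_pre_digraph \<Rightarrow> 'b pair_pre_digraph \<Rightarrow> real \<Rightarrow> bool" where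
  "has_domination_exponent G H c \<longleftrightarrow>
    c \<in> domination_exponents G H \<and> (\<forall>c' \<in> domination_exponents G H. c \<le> c')"

end

theory Submission
  imports Defs
begin

text \<open>
  Let \<open>w\<^sub>m\<close> be the number of \<open>m\<close>-walks in \<open>T\<close> and \<open>n\<close> the number of vertices. Three inequalities
  suffice for the upper bounds: \<open>w\<^bsub>p+q+1\<^esub> \<le> w\<^sub>p w\<^sub>q\<close>, the Cauchy-Schwarz inequality
  \<open>w\<^bsub>p+q\<^esub>\<^sup>2 \<le> w\<^bsub>2p\<^esub> w\<^bsub>2q\<^esub>\<close>, and the Erdos-Simonovits inequality
  \<open>(w\<^bsub>l+2\<^esub>/n)\<^bsup>1/(l+2)\<^esup> \<ge> (w\<^sub>l/n)\<^bsup>1/l\<^esup>\<close>. The last one is an entropy argument: in a random \<open>l\<close>-walk,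
  traverse a uniformly chosen arc three times.

  The lower bounds come from blow-ups of paths, whose layers have sizes \<open>N\<^bsup>D-m\<^esup>\<close> and whose consecutive
  layers are joined with density \<open>N\<^bsup>-e\<^esup>\<close>. In the odd-odd case, \<open>m\<close> and \<open>e\<close> are chosen so
  that \<open>m\<^sub>i + m\<^bsub>i+1\<^esub> + 2 e\<^sub>i = 2 (a + 1)\<close> on every edge of \<open>P\<^sub>l\<close>; the exponent of the number of walks
  along a given sequence of layers then depends only on the length and the two end layers.
\<close>

section \<open>Walk counts\<close>

primrec walks_from :: "'a pair_pre_digraph \<Rightarrow> nat \<Rightarrow> 'a \<Rightarrow> nat" where
  "walks_from T 0 v = 1"
| "walks_from T (Suc m) v = (\<Sum>u | (v, u) \<in> parcs T. walks_from T m u)"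

definition walk_count :: "'a pair_pre_digraph \<Rightarrow> nat \<Rightarrow> nat" where
  "walk_count T m = (\<Sum>v\<in>pverts T. walks_from T m v)"

lemma (in pair_graph) arc_sym: "(u, v) \<in> parcs G \<Longrightarrow> (v, u) \<in> parcs G"
  using pair_sym_arcs by (auto simp: symmetric_def sym_def)

lemma graph_homs_path_graph:
  assumes "pair_graph T"
  shows "graph_homs (path_graph m) T =
    {f \<in> {0..m} \<rightarrow>\<^sub>E pverts T. \<forall>i<m. (f i, f (Suc i)) \<in> parcs T}"
proof -
  interpret T: pair_graph T by fact
  show ?thesis
    unfolding graph_homs_def path_graph_def by (auto intro: T.arc_sym)
qed

text \<open>Homomorphisms are sorted by the image \<open>v\<close> of the last path vertex. Deleting
  that vertex leaves a homomorphism of the shorter path ending in a neighbour of \<open>v\<close>,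
  which is the recursion of \<open>walks_from\<close> read from the far end of the path.\<close>

lemma hom_count_path_graph:
  assumes "pair_graph T"
  shows "hom_count (path_graph m) T = walk_count T m"
proof -
  interpret T: pair_graph T by fact
  note fin = T.pair_finite_verts
  define S where
    "S m v = {f \<in> {0..m} \<rightarrow>\<^sub>E pverts T. (\<forall>i<m. (f i, f (Suc i)) \<in> parcs T) \<and> f m = v}"
    for m v
  have finS: "finite (S m v)" for m v
    unfolding S_def by (rule finite_subset[OF _ finite_PiE[of "{0..m}" "\<lambda>_. pverts T"]]) (use fin in auto)
  have S_Suc: "S (Suc m) v = (\<Union>u\<in>{u. (v, u) \<in> parcs T}. (\<lambda>f. f(Suc m := v)) ` S m u)"
    for m v
  proof (intro equalityI subsetI)
    fix f assume f: "f \<in> S (Suc m) v"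
    define g where "g = restrict f {0..m}"
    have "g \<in> S m (f m)" using f by (auto simp: S_def g_def PiE_iff)
    moreover have "f = g(Suc m := v)"
      using f by (auto simp: S_def g_def PiE_iff fun_eq_iff extensional_def)
    moreover have "(v, f m) \<in> parcs T" using f by (auto simp: S_def intro: T.arc_sym)
    ultimately show "f \<in> (\<Union>u\<in>{u. (v, u) \<in> parcs T}. (\<lambda>f. f(Suc m := v)) ` S m u)"
      by blast
  next
    fix f assume "f \<in> (\<Union>u\<in>{u. (v, u) \<in> parcs T}. (\<lambda>f. f(Suc m := v)) ` S m u)"
    then obtain u g where u: "(v, u) \<in> parcs T" "g \<in> S m u" "f = g(Suc m := v)" by blast
    then show "f \<in> S (Suc m) v"
      using T.arc_sym[OF u(1)] T.in_arcsD1[OF u(1)]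
      by (auto simp: S_def PiE_iff extensional_def less_Suc_eq)
  qed
  have card_S: "card (S m v) = walks_from T m v" if "v \<in> pverts T" for m v
    using that
  proof (induction m arbitrary: v)
    case 0
    have "S 0 v = {\<lambda>i\<in>{0}. v}"
      using 0 by (auto simp: S_def PiE_iff extensional_def fun_eq_iff)
    then show ?case by simp
  next
    case (Suc m)
    have inj: "inj_on (\<lambda>f. f(Suc m := v)) (S m u)" for u
    proof (rule inj_onI)
      fix f g assume fg: "f \<in> S m u" "g \<in> S m u" "f(Suc m := v) = g(Suc m := v)"
      have "f i = g i" for i
      proof (cases "i = Suc m")
        case True
        then show ?thesis using fg by (auto simp: S_def PiE_iff extensional_def)
      next
        case False
        then show ?thesis using fun_cong[OF fg(3), of i] by simp
      qed
      then show "f = g" by blast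
    qed
    \<comment> \<open>The update at \<open>Suc m\<close> keeps the value at \<open>m\<close>, so the
      extended map still reveals \<open>u\<close>.\<close>
    have disj: "(\<lambda>f. f(Suc m := v)) ` S m u \<inter> (\<lambda>f. f(Suc m := v)) ` S m u' = {}"
      if "u \<noteq> u'" for u u'
    proof -
      have "h m = u" if "h \<in> (\<lambda>f. f(Suc m := v)) ` S m u" for h u
        using that by (auto simp: S_def)
      with that show ?thesis by blast
    qed
    have "finite {u. (v, u) \<in> parcs T}"
      by (rule finite_subset[OF _ fin]) (auto dest: T.in_arcsD2)
    then have "card (S (Suc m) v)
        = (\<Sum>u | (v, u) \<in> parcs T. card ((\<lambda>f. f(Suc m := v)) ` S m u))"
      unfolding S_Suc using finS disj by (intro card_UN_disjoint) auto
    also have "\<dots> = (\<Sum>u | (v, u) \<in> parcs T. walks_from T m u)"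
      by (intro sum.cong refl) (auto simp: card_image[OF inj] Suc.IH dest: T.in_arcsD2)
    finally show ?case by simp
  qed
  have "graph_homs (path_graph m) T = (\<Union>v\<in>pverts T. S m v)"
    unfolding graph_homs_path_graph[OF assms] S_def by (auto simp: PiE_iff)
  then have "card (graph_homs (path_graph m) T) = (\<Sum>v\<in>pverts T. card (S m v))"
    using fin finS by (simp, intro card_UN_disjoint) (auto simp: S_def)
  then show ?thesis
    by (simp add: hom_count_def walk_count_def card_S)
qed

lemma hom_density_path_graph:
  assumes "pair_graph T"
  shows "hom_density (path_graph m) T = walk_count T m / real (card (pverts T)) ^ Suc m"
  using hom_count_path_graph[OF assms, of m] by (simp add: hom_density_def path_graph_def)

section \<open>Identities and inequalities between walk counts\<close>

context pair_graph
begin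

lemma finite_neighbours: "finite {u. (v, u) \<in> parcs G}"
  by (rule finite_subset[OF _ pair_finite_verts]) (auto dest: in_arcsD2)

lemma sum_arcs_eq:
  fixes h :: "'a \<Rightarrow> 'a \<Rightarrow> 'b::comm_monoid_add"
  shows "(\<Sum>(u, v)\<in>parcs G. h u v) = (\<Sum>u\<in>pverts G. \<Sum>v | (u, v) \<in> parcs G. h u v)"
proof -
  have "parcs G = Sigma (pverts G) (\<lambda>u. {v. (u, v) \<in> parcs G})"
    by (auto dest: in_arcsD1)
  then show ?thesis
    using sum.Sigma[of "pverts G" "\<lambda>u. {v. (u, v) \<in> parcs G}" h]
      pair_finite_verts finite_neighbours by auto
qed

lemma sum_arcs_swap:
  fixes h :: "'a \<Rightarrow> 'a \<Rightarrow> 'b::comm_monoid_add"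
  shows "(\<Sum>(u, v)\<in>parcs G. h u v) = (\<Sum>(u, v)\<in>parcs G. h v u)"
  by (rule sum.reindex_bij_witness[of _ prod.swap prod.swap]) (auto intro: arc_sym)

lemma sum_arcs_walks_right:
  fixes f :: "'a \<Rightarrow> real"
  shows "(\<Sum>(u, v)\<in>parcs G. f u * walks_from G j v) = (\<Sum>u\<in>pverts G. f u * walks_from G (Suc j) u)"
  by (simp add: sum_arcs_eq sum_distrib_left)

lemma sum_arcs_walks_left:
  fixes g :: "'a \<Rightarrow> real"
  shows "(\<Sum>(u, v)\<in>parcs G. walks_from G i u * g v) = (\<Sum>v\<in>pverts G. walks_from G (Suc i) v * g v)"
  using sum_arcs_walks_right[of g i] by (subst sum_arcs_swap) (simp add: mult.commute)

text \<open>An \<open>i\<close>-walk and a \<open>j\<close>-walk with common start \<open>v\<close>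
  form an \<open>(i + j)\<close>-walk. The induction moves one step at a time from the first walk to
  the second, using the symmetry of sums over arcs.\<close>

lemma sum_walks_mult:
  "(\<Sum>v\<in>pverts G. real (walks_from G i v) * real (walks_from G j v)) = walk_count G (i + j)"
proof (induction i arbitrary: j)
  case 0
  then show ?case by (simp add: walk_count_def)
next
  case (Suc i)
  have "(\<Sum>v\<in>pverts G. real (walks_from G (Suc i) v) * real (walks_from G j v))
      = (\<Sum>v\<in>pverts G. real (walks_from G i v) * real (walks_from G (Suc j) v))"
    unfolding sum_arcs_walks_left[symmetric] sum_arcs_walks_right[symmetric] ..
  then show ?case
    unfolding Suc.IH by simp
qed

lemma sum_arcs_walks:
  "(\<Sum>(u, v)\<in>parcs G. real (walks_from G i u) * real (walks_from G j v)) = walk_count G (Suc (i + j))"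
  using sum_arcs_walks_right[of "walks_from G i" j] sum_walks_mult[of i "Suc j"] by simp

lemma walk_count_0: "walk_count G 0 = card (pverts G)"
  by (simp add: walk_count_def)

text \<open>Removing one arc cuts a walk into a \<open>p\<close>-walk and a \<open>q\<close>-walk;
  the sum over arcs is then enlarged to all pairs of vertices.\<close>

lemma walk_count_submult: "walk_count G (Suc (p + q)) \<le> walk_count G p * walk_count G q"
proof -
  have "real (walk_count G (Suc (p + q)))
      = (\<Sum>(u, v)\<in>parcs G. real (walks_from G p u) * real (walks_from G q v))"
    by (simp add: sum_arcs_walks)
  also have "\<dots> \<le> (\<Sum>(u, v)\<in>pverts G \<times> pverts G. real (walks_from G p u) * real (walks_from G q v))"
    by (rule sum_mono2) (auto simp: pair_finite_verts dest: in_arcsD1 in_arcsD2)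
  also have "\<dots> = real (walk_count G p * walk_count G q)"
    by (simp add: walk_count_def sum_product sum.cartesian_product[symmetric])
  finally show ?thesis by linarith
qed

text \<open>Cutting walks at a vertex turns the three counts into inner products of the vectors
  \<open>walks_from G p\<close> and \<open>walks_from G q\<close>.\<close>

lemma walk_count_Cauchy_Schwarz:
  "real (walk_count G (p + q)) ^ 2 \<le> walk_count G (2 * p) * walk_count G (2 * q)"
  using Cauchy_Schwarz_ineq_sum[of "walks_from G p" "walks_from G q" "pverts G"]
  by (simp add: sum_walks_mult power2_eq_square mult_2)

lemma walks_from_pos:
  assumes "(u, v) \<in> parcs G"
  shows "walks_from G m u > 0"
  using assms
proof (induction m arbitrary: u v)
  case (Suc m)
  have "walks_from G m v > 0" using Suc.IH arc_sym Suc.prems by blast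
  also have "\<dots> \<le> (\<Sum>w | (u, w) \<in> parcs G. walks_from G m w)"
    using member_le_sum[of v "{w. (u, w) \<in> parcs G}" "walks_from G m"] finite_neighbours Suc.prems
    by simp
  finally show ?case by simp
qed simp

lemma walk_count_pos:
  assumes "parcs G \<noteq> {}"
  shows "walk_count G m > 0"
proof -
  from assms obtain u v where uv: "(u, v) \<in> parcs G" by auto
  have "walks_from G m u \<le> walk_count G m"
    unfolding walk_count_def
    by (rule member_le_sum) (use uv in_arcsD1 pair_finite_verts in auto)
  with walks_from_pos[OF uv, of m] show ?thesis by linarith
qed

lemma walk_count_eq_0:
  assumes "parcs G = {}" "m > 0"
  shows "walk_count G m = 0"
  using assms by (cases m) (auto simp: walk_count_def)

text \<open>
  For every \<open>i < l\<close>, an \<open>l\<close>-walk whose \<open>i\<close>-th arc is traversed three times is an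
  \<open>(l + 2)\<close>-walk. Jensen's inequality for the distribution of the \<open>i\<close>-th arc of a uniformly
  random \<open>l\<close>-walk bounds the growth from below; the bounds telescope over \<open>i\<close>.
\<close>

lemma walk_count_Suc_Suc:
  assumes ne: "parcs G \<noteq> {}"
  shows "real l * ln (walk_count G (l + 2) / walk_count G l)
    \<ge> 2 * ln (walk_count G l / card (pverts G))"
proof -
  define a where "a j v = real (walks_from G j v)" for j v
  define W where "W = real (walk_count G l)"
  define W2 where "W2 = real (walk_count G (l + 2))"
  define R where "R = W2 / W"
  define n where "n = real (card (pverts G))"
  \<comment> \<open>\<open>\<Phi> j / W\<close> is the mean of \<open>ln (a j v)\<close> for the
    vertex \<open>v\<close> at position \<open>j\<close> of a uniformly random
    \<open>l\<close>-walk.\<close>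
  define \<Phi> where "\<Phi> j = (\<Sum>v\<in>pverts G. a j v * a (l - j) v * ln (a j v))" for j
  have W: "W > 0" "W2 > 0" using walk_count_pos[OF ne] by (auto simp: W_def W2_def)
  have R: "R > 0" using W by (simp add: R_def)
  have n: "n > 0" using walk_count_pos[OF ne, of 0] by (simp add: walk_count_0 n_def)
  have step: "\<Phi> (Suc i) - \<Phi> i + (\<Phi> (l - i) - \<Phi> (l - Suc i)) \<le> W * ln R" if i: "i < l" for i
  proof -
    define j where "j = l - Suc i"
    have j: "l - i = Suc j" "l - Suc i = j" "l = Suc (i + j)" "l - j = Suc i" "l - Suc j = i"
      using i by (auto simp: j_def)
    have eq: "a i u * a j v * (ln (a (Suc i) v) + ln (a (Suc j) u) - ln (a i u) - ln (a j v))
        \<le> a (Suc j) u * a (Suc i) v / R + a i u * a j v * (ln R - 1)"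
      if uv: "(u, v) \<in> parcs G" for u v
    proof -
      have pos: "a m u > 0" "a m v > 0" for m
        using walks_from_pos[OF uv] walks_from_pos[OF arc_sym[OF uv]] by (auto simp: a_def)
      \<comment> \<open>\<open>R\<close> gives \<open>x\<close> mean one under the weights
        \<open>a i u * a j v\<close> on arcs, so the tangent bound \<open>ln x \<le> x - 1\<close>
        does the work of Jensen's inequality.\<close>
      define x where "x = a (Suc i) v * a (Suc j) u / (a i u * a j v * R)"
      have x: "x > 0" using pos R by (simp add: x_def)
      have "ln (a (Suc i) v) + ln (a (Suc j) u) - ln (a i u) - ln (a j v) = ln x + ln R"
        unfolding x_def using pos[of i] pos[of j] pos[of "Suc i"] pos[of "Suc j"] R
        by (simp add: ln_divide_pos ln_mult_pos)
      also have "\<dots> \<le> x - 1 + ln R" using ln_le_minus_one[OF x] by simp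
      finally have "a i u * a j v * (ln (a (Suc i) v) + ln (a (Suc j) u) - ln (a i u) - ln (a j v))
          \<le> a i u * a j v * (x - 1 + ln R)"
        using pos by (intro mult_left_mono) (auto simp: less_imp_le)
      also have "\<dots> = a i u * a j v * x + a i u * a j v * (ln R - 1)" by (simp add: algebra_simps)
      also have "a i u * a j v * x = a (Suc j) u * a (Suc i) v / R"
        using pos[of i] pos[of j] R by (simp add: x_def)
      finally show ?thesis .
    qed
    have s1: "(\<Sum>(u, v)\<in>parcs G. a i u * (a j v * ln (a (Suc i) v))) = \<Phi> (Suc i)"
      using sum_arcs_walks_left[of i "\<lambda>v. a j v * ln (a (Suc i) v)"]
      by (simp only: \<Phi>_def j(1,2,4,5) a_def mult.assoc)
    have s2: "(\<Sum>(u, v)\<in>parcs G. (a i u * ln (a (Suc j) u)) * a j v) = \<Phi> (Suc j)"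
      using sum_arcs_walks_right[of "\<lambda>u. a i u * ln (a (Suc j) u)" j]
      by (simp only: \<Phi>_def j(1,2,4,5) a_def mult_ac)
    have s3: "(\<Sum>(u, v)\<in>parcs G. (a i u * ln (a i u)) * a j v) = \<Phi> i"
      using sum_arcs_walks_right[of "\<lambda>u. a i u * ln (a i u)" j]
      by (simp only: \<Phi>_def j(1,2,4,5) a_def mult_ac)
    have s4: "(\<Sum>(u, v)\<in>parcs G. a i u * (a j v * ln (a j v))) = \<Phi> j"
      using sum_arcs_walks_left[of i "\<lambda>v. a j v * ln (a j v)"]
      by (simp only: \<Phi>_def j(1,2,4,5) a_def mult_ac)
    have "\<Phi> (Suc i) - \<Phi> i + (\<Phi> (l - i) - \<Phi> (l - Suc i))
      = (\<Sum>(u, v)\<in>parcs G. a i u * a j v * (ln (a (Suc i) v) + ln (a (Suc j) u) - ln (a i u) - ln (a j v)))"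
      unfolding j(1,2) s1[symmetric] s2[symmetric] s3[symmetric] s4[symmetric]
        sum_subtractf[symmetric] sum.distrib[symmetric]
      by (intro sum.cong refl) (auto simp: algebra_simps)
    also have "\<dots> \<le> (\<Sum>(u, v)\<in>parcs G. a (Suc j) u * a (Suc i) v / R + a i u * a j v * (ln R - 1))"
      using eq by (intro sum_mono) auto
    also have "\<dots> = (\<Sum>(u, v)\<in>parcs G. a (Suc j) u * a (Suc i) v) / R
        + (\<Sum>(u, v)\<in>parcs G. a i u * a j v) * (ln R - 1)"
      unfolding sum_divide_distrib sum_distrib_right sum.distrib[symmetric]
      by (intro sum.cong refl) auto
    also have "(\<Sum>(u, v)\<in>parcs G. a (Suc j) u * a (Suc i) v) = W2"
      unfolding a_def sum_arcs_walks W2_def j(3) by (simp add: ac_simps)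
    also have "(\<Sum>(u, v)\<in>parcs G. a i u * a j v) = W"
      unfolding a_def sum_arcs_walks W_def j(3) ..
    also have "W2 / R + W * (ln R - 1) = W * ln R"
      using W by (simp add: R_def algebra_simps)
    finally show ?thesis .
  qed
  \<comment> \<open>The sums along \<open>i\<close> and along \<open>l - i\<close> both telescope to
    \<open>\<Phi> l - \<Phi> 0\<close>, whence the factor 2.\<close>
  have "2 * (\<Phi> l - \<Phi> 0) = (\<Sum>i<l. \<Phi> (Suc i) - \<Phi> i) + (\<Sum>i<l. \<Phi> (l - i) - \<Phi> (l - Suc i))"
    using sum_lessThan_telescope[of \<Phi> l] sum_lessThan_telescope'[of "\<lambda>i. \<Phi> (l - i)" l]
    by simp
  also have "\<dots> \<le> (\<Sum>i<l. W * ln R)"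
    unfolding sum.distrib[symmetric] by (intro sum_mono step) auto
  finally have upper: "2 * (\<Phi> l - \<Phi> 0) \<le> W * (real l * ln R)" by (simp add: mult.left_commute)
  have \<Phi>0: "\<Phi> 0 = 0" by (simp add: \<Phi>_def a_def)
  \<comment> \<open>Convexity of \<open>t * ln t\<close>: its tangent at the average
    \<open>W / n\<close> is summed over all vertices, where the terms \<open>a l v - W / n\<close>
    cancel.\<close>
  have "W * ln (W / n) = (\<Sum>v\<in>pverts G. a l v * ln (W / n) + a l v - W / n)"
  proof -
    have "(\<Sum>v\<in>pverts G. a l v) = W" by (simp add: W_def walk_count_def a_def)
    then show ?thesis
      using n by (auto simp add: sum_subtractf sum.distrib sum_distrib_right[symmetric] n_def)
  qed
  also have "\<dots> \<le> (\<Sum>v\<in>pverts G. a l v * ln (a l v))"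
  proof (rule sum_mono)
    fix v
    show "a l v * ln (W / n) + a l v - W / n \<le> a l v * ln (a l v)"
    proof (cases "a l v = 0")
      case False
      then have av: "a l v > 0" by (simp add: a_def)
      have Wn: "W / n > 0" using W n by simp
      have "ln (W / n) - ln (a l v) = ln (W / n / a l v)"
        by (rule ln_divide_pos[OF Wn av, symmetric])
      also have "\<dots> \<le> W / n / a l v - 1"
        by (intro ln_le_minus_one divide_pos_pos[OF Wn av])
      finally have "a l v * (ln (W / n) - ln (a l v)) \<le> a l v * (W / n / a l v - 1)"
        using av by (intro mult_left_mono) auto
      then show ?thesis using av by (simp add: algebra_simps)
    qed (use W n in simp)
  qed
  also have "\<dots> = \<Phi> l" by (simp add: \<Phi>_def a_def)
  finally have lower: "W * ln (W / n) \<le> \<Phi> l - \<Phi> 0" unfolding \<Phi>0 by simp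
  have "W * (2 * ln (W / n)) = 2 * (W * ln (W / n))" by (rule mult.left_commute)
  also have "\<dots> \<le> 2 * (\<Phi> l - \<Phi> 0)" by (intro mult_left_mono lower) simp
  also note upper
  finally have "2 * ln (W / n) \<le> real l * ln R" using W by (simp add: mult_le_cancel_left)
  then show ?thesis by (simp add: R_def W_def W2_def n_def)
qed

end

section \<open>Upper bounds\<close>

text \<open>The properties of \<open>x m = ln (t (P\<^sub>m, T))\<close> from which all upper bounds follow.\<close>

locale log_path_densities =
  fixes x :: "nat \<Rightarrow> real"
  assumes zero: "x 0 = 0"
    and disjoint_union: "x (Suc (p + q)) \<le> x p + x q"
    and Cauchy_Schwarz: "2 * x (p + q) \<le> x (2 * p) + x (2 * q)"
    and add_two: "real l * x (l + 2) \<ge> (real l + 2) * x l"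
begin

text \<open>By \<open>add_two\<close>, \<open>x m / m\<close> does not decrease from
  \<open>m\<close> to \<open>m + 2\<close>; the induction chains such steps.\<close>

lemma same_parity_growth:
  assumes "l \<ge> 1"
  shows "real l * x (l + 2 * j) \<ge> real (l + 2 * j) * x l"
proof (induction j)
  case (Suc j)
  define m where "m = l + 2 * j"
  have m: "real m > 0" "real l > 0" using assms by (auto simp: m_def)
  have "real m * (real (m + 2) * x l) = real (m + 2) * (real m * x l)" by simp
  also have "\<dots> \<le> real (m + 2) * (real l * x m)"
    using Suc by (intro mult_left_mono) (auto simp: m_def)
  also have "\<dots> = real l * ((real m + 2) * x m)" by simp
  also have "\<dots> \<le> real l * (real m * x (m + 2))"
    using add_two[of m] by (intro mult_left_mono) auto
  also have "\<dots> = real m * (real l * x (m + 2))" by simp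
  finally have "real (m + 2) * x l \<le> real l * x (m + 2)"
    using m by simp
  then show ?case by (simp add: m_def algebra_simps)
qed simp

text \<open>Equal parities are covered by steps of two. Otherwise \<open>l\<close> is odd and
  \<open>k\<close> even, and one step from \<open>l\<close> to \<open>l + 1\<close> comes first:
  Cauchy-Schwarz bounds \<open>x l\<close> by the average of its even neighbours, and
  \<open>add_two\<close> bounds the lower neighbour by the upper one.\<close>

lemma growth:
  assumes "1 \<le> l" "l \<le> k" "even k \<or> odd l"
  shows "real l * x k \<ge> real k * x l"
proof (cases "even (k - l)")
  case True
  then obtain j where "k - l = 2 * j" by (elim evenE)
  with assms(2) have "k = l + 2 * j" by simp
  then show ?thesis using same_parity_growth[OF assms(1)] by simp
next
  case False
  with assms(2) have "even k \<longleftrightarrow> odd l" by (simp add: even_diff_nat)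
  with assms(3) have par: "even k" "odd l" by blast+
  then obtain p where l: "l = 2 * p + 1" by (elim oddE)
  have *: "real l * x (l + 1) \<ge> real (l + 1) * x l"
  proof -
    have 1: "2 * x l \<le> x (2 * p) + x (2 * p + 2)"
    proof -
      have "p + (p + 1) = l" "2 * (p + 1) = 2 * p + 2" by (auto simp: l)
      then show ?thesis using Cauchy_Schwarz[of p "p + 1"] by simp
    qed
    have 2: "real (2 * p) * x (2 * p + 2) \<ge> (real (2 * p) + 2) * x (2 * p)"
      by (rule add_two)
    have "(real p + 1) * (2 * x l) \<le> (real p + 1) * (x (2 * p) + x (2 * p + 2))"
      using 1 by (intro mult_left_mono) auto
    with 2 show ?thesis by (simp add: l algebra_simps)
  qed
  have "even (k - (l + 1))" using par by (simp add: even_diff_nat)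
  then obtain j where "k - (l + 1) = 2 * j" by (elim evenE)
  moreover have "l \<noteq> k" using par by auto
  ultimately have k: "k = l + 1 + 2 * j" using assms(2) by simp
  have "real (l + 1) * (real k * x l) = real k * (real (l + 1) * x l)" by simp
  also have "\<dots> \<le> real k * (real l * x (l + 1))" using * by (intro mult_left_mono) auto
  also have "\<dots> = real l * (real k * x (l + 1))" by simp
  also have "\<dots> \<le> real l * (real (l + 1) * x k)"
    using same_parity_growth[of "l + 1" j] by (intro mult_left_mono) (auto simp: k)
  also have "\<dots> = real (l + 1) * (real l * x k)" by simp
  finally show ?thesis by (simp add: mult_le_cancel_left)
qed

text \<open>For \<open>l < k + 1\<close>, \<open>growth\<close> compares \<open>l\<close> with the
  even number \<open>k + 1\<close>, and dropping an end vertex gives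
  \<open>x (k + 1) \<le> x k\<close>. A longer path loses a copy of the path with \<open>k\<close>
  edges, that is \<open>k + 1\<close> vertices, and the remaining length is again even.\<close>

lemma odd_even_bound:
  assumes "odd k" "even l"
  shows "(real k + 1) * x l \<le> real l * x k"
  using assms(2)
proof (induction l rule: less_induct)
  case (less l)
  consider "l = 0" | "0 < l" "l < k + 1" | "l \<ge> k + 1" by linarith
  then show ?case
  proof cases
    case 1
    then show ?thesis by (simp add: zero)
  next
    case 2
    have "real (k + 1) * x l \<le> real l * x (k + 1)"
      using 2 assms by (intro growth) auto
    also have "\<dots> \<le> real l * x k"
      using disjoint_union[of k 0] zero by (intro mult_left_mono) auto
    finally show ?thesis by (simp add: add.commute)
  next
    case 3
    then obtain m where "l = k + 1 + m" using le_Suc_ex by blast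
    then have l: "l = Suc (k + m)" by simp
    have "even m" using less.prems assms(1) l by simp
    then have "(real k + 1) * x m \<le> real m * x k" using less.IH l by simp
    moreover have "(real k + 1) * x l \<le> (real k + 1) * (x k + x m)"
      unfolding l by (intro mult_left_mono disjoint_union) auto
    ultimately show ?thesis by (simp add: l algebra_simps)
  qed
qed

text \<open>Cauchy-Schwarz makes \<open>x\<close> convex on even indices, so the first increment
  after \<open>k\<close> is at most the average of the first \<open>k + 1\<close> increments. These
  lead to a path that splits into three copies of the path with \<open>k\<close> edges.\<close>

lemma even_step:
  assumes "even k"
  shows "(real k + 1) * x (k + 2) \<le> (real k + 3) * x k"
proof -
  obtain s where k: "k = 2 * s" using assms by (elim evenE)
  define d where "d j = x (2 * (s + Suc j)) - x (2 * (s + j))" for j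
  have "d j \<le> d (Suc j)" for j
  proof -
    have "s + j + (s + Suc (Suc j)) = 2 * (s + Suc j)" by simp
    then show ?thesis using Cauchy_Schwarz[of "s + j" "s + Suc (Suc j)"] by (simp only: d_def)
  qed
  then have d0: "d 0 \<le> d j" for j
    using lift_Suc_mono_le[of d 0 j] by simp
  \<comment> \<open>\<open>Suc k\<close> increments of index 2 lead from \<open>k\<close> to
    \<open>3 * k + 2\<close>, the length of a path with \<open>3 * (k + 1)\<close> vertices.\<close>
  have "real (Suc k) * d 0 \<le> (\<Sum>j<Suc k. d j)"
    using sum_mono[of "{..<Suc k}" "\<lambda>_. d 0" d] d0 by simp
  also have "\<dots> = x (2 * (s + Suc k)) - x (2 * s)"
    unfolding d_def using sum_lessThan_telescope[of "\<lambda>j. x (2 * (s + j))" "Suc k"] by simp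
  also have "2 * (s + Suc k) = Suc (k + Suc (k + k))" by (simp add: k)
  also have "x (Suc (k + Suc (k + k))) \<le> 3 * x k"
    using disjoint_union[of k "Suc (k + k)"] disjoint_union[of k k] by simp
  finally show ?thesis by (simp add: d_def k algebra_simps)
qed

text \<open>For even \<open>l\<close> the bounds of \<open>even_step\<close> are chained. For odd
  \<open>l\<close>, Cauchy-Schwarz reduces to the even neighbours; nothing is lost because the
  right-hand side is linear in \<open>l\<close>.\<close>

lemma even_bound:
  assumes "even k" "k \<le> l"
  shows "(real k + 1) * x l \<le> (real l + 1) * x k"
proof -
  have ev: "(real k + 1) * x (k + 2 * j) \<le> (real (k + 2 * j) + 1) * x k" for j
  proof (induction j)
    case (Suc j)
    define m where "m = k + 2 * j"
    have "(real m + 1) * ((real k + 1) * x (m + 2)) = (real k + 1) * ((real m + 1) * x (m + 2))"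
      by simp
    also have "\<dots> \<le> (real k + 1) * ((real m + 3) * x m)"
      using assms(1) by (intro mult_left_mono even_step) (auto simp: m_def)
    also have "\<dots> = (real m + 3) * ((real k + 1) * x m)" by simp
    also have "\<dots> \<le> (real m + 3) * ((real m + 1) * x k)"
      using Suc by (intro mult_left_mono) (auto simp: m_def)
    also have "\<dots> = (real m + 1) * ((real m + 3) * x k)" by simp
    finally have "(real k + 1) * x (m + 2) \<le> (real m + 3) * x k"
      by (simp add: mult_le_cancel_left)
    then show ?case by (simp add: m_def algebra_simps)
  qed simp
  show ?thesis
  proof (cases "even l")
    case True
    with assms(1) have "even (l - k)" by simp
    then obtain j where "l - k = 2 * j" by (elim evenE)
    with assms(2) have "l = k + 2 * j" by simp
    with ev show ?thesis by simp
  next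
    case False
    then obtain m where m: "l = Suc m" "even m" by (cases l) auto
    with assms have km: "even (m - k)" "k \<le> m" by (auto simp: le_Suc_eq)
    then obtain j where "m - k = 2 * j" by (elim evenE)
    with km(2) m(1) have l: "l = k + 2 * j + 1" by simp
    obtain s where k: "k = 2 * s" using assms(1) by (elim evenE)
    have "2 * x l \<le> x (k + 2 * j) + x (k + 2 * Suc j)"
    proof -
      have "s + j + (s + Suc j) = l" "2 * (s + j) = k + 2 * j" "2 * (s + Suc j) = k + 2 * Suc j"
        by (auto simp: l k)
      then show ?thesis using Cauchy_Schwarz[of "s + j" "s + Suc j"] by simp
    qed
    then have "(real k + 1) * (2 * x l) \<le> (real k + 1) * (x (k + 2 * j) + x (k + 2 * Suc j))"
      by (intro mult_left_mono) auto
    with ev[of j] ev[of "Suc j"] show ?thesis by (simp add: l algebra_simps)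
  qed
qed

lemma disjoint_copies: "x (Suc a * Suc k - 1) \<le> (real a + 1) * x k"
proof (induction a)
  case (Suc a)
  have "Suc (Suc a) * Suc k - 1 = Suc (k + (Suc a * Suc k - 1))" by simp
  then show ?case
    using disjoint_union[of k "Suc a * Suc k - 1"] Suc by (simp add: algebra_simps)
qed simp

text \<open>\<open>l\<close> is compared by \<open>growth\<close> with the length of the path on
  \<open>Suc a * Suc k\<close> vertices, which splits into \<open>a + 1\<close> copies of the path
  with \<open>k\<close> edges.\<close>

lemma odd_odd_bound:
  assumes "odd k" "odd l" "l \<le> Suc a * Suc k - 1"
  shows "(real (Suc a * Suc k) - 1) * x l \<le> (real a + 1) * real l * x k"
proof -
  define L where "L = Suc a * Suc k - 1"
  have L: "real L = real (Suc a * Suc k) - 1" unfolding L_def by (subst of_nat_diff) auto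
  have "1 \<le> l" using assms(2) by (cases l) auto
  then have "real L * x l \<le> real l * x L"
    using assms by (intro growth) (auto simp only: L_def)
  also have "\<dots> \<le> real l * ((real a + 1) * x k)"
    unfolding L_def by (intro mult_left_mono disjoint_copies) auto
  finally show ?thesis unfolding L by (simp only: mult_ac)
qed

end

section \<open>From walk counts to logarithms of densities\<close>

context pair_graph
begin

text \<open>The normalising terms \<open>(m + 1) * ln n\<close> cancel in the disjoint-union and
  Cauchy-Schwarz inequalities; in the last one they leave exactly the \<open>ln n\<close> of
  \<open>walk_count_Suc_Suc\<close>. An arc makes all counts positive, so the logarithms are
  genuine.\<close>

lemma log_path_densities:
  assumes ne: "parcs G \<noteq> {}"
  shows "log_path_densities (\<lambda>m. ln (hom_density (path_graph m) G))"
proof -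
  define n where "n = real (card (pverts G))"
  define w where "w m = real (walk_count G m)" for m
  define x where "x m = ln (w m) - (real m + 1) * ln n" for m
  have w: "w m > 0" for m using walk_count_pos[OF ne] by (simp add: w_def)
  have w0: "w 0 = n" by (simp add: w_def n_def walk_count_0)
  have n: "n > 0" using w[of 0] w0 by simp
  have x: "ln (hom_density (path_graph m) G) = x m" for m
  proof -
    have "hom_density (path_graph m) G = w m / n ^ Suc m"
      by (simp add: hom_density_path_graph[OF pair_graph] w_def n_def)
    then show ?thesis
      using w[of m] n by (simp add: x_def ln_divide_pos ln_mult_pos ln_realpow algebra_simps)
  qed
  show ?thesis
    unfolding x
  proof
    show "x 0 = 0" by (simp add: x_def w0)
    show "x (Suc (p + q)) \<le> x p + x q" for p q
    proof -
      have "w (Suc (p + q)) \<le> w p * w q"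
        unfolding w_def using walk_count_submult[of p q] by (simp flip: of_nat_mult)
      then have "ln (w (Suc (p + q))) \<le> ln (w p * w q)" using w by simp
      also have "\<dots> = ln (w p) + ln (w q)" using w by (simp add: ln_mult_pos)
      finally show ?thesis by (simp add: x_def algebra_simps)
    qed
    show "2 * x (p + q) \<le> x (2 * p) + x (2 * q)" for p q
    proof -
      have "w (p + q) ^ 2 \<le> w (2 * p) * w (2 * q)"
        unfolding w_def using walk_count_Cauchy_Schwarz[of p q] by simp
      then have "ln (w (p + q) ^ 2) \<le> ln (w (2 * p) * w (2 * q))"
        using w[of "p + q"] by (intro ln_mono) auto
      also have "\<dots> = ln (w (2 * p)) + ln (w (2 * q))" using w by (simp add: ln_mult_pos)
      also have "ln (w (p + q) ^ 2) = 2 * ln (w (p + q))" using w by (simp add: ln_realpow)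
      finally show ?thesis by (simp add: x_def algebra_simps)
    qed
    show "real l * x (l + 2) \<ge> (real l + 2) * x l" for l
    proof -
      have "real l * (ln (w (l + 2)) - ln (w l)) \<ge> 2 * (ln (w l) - ln n)"
        using walk_count_Suc_Suc[OF ne, of l] w[of l] w[of "l + 2"] n
        by (simp add: w_def n_def ln_divide_pos)
      then show ?thesis by (simp add: x_def algebra_simps)
    qed
  qed
qed

end

text \<open>On a target with an arc, the linear bound is exponentiated. Without arcs the longer side
  of the argument is trivial: as \<open>l \<ge> 1\<close>, the density of
  \<open>path_graph l\<close> is 0, and so is its \<open>powr\<close>.\<close>

lemma domination_exponentI:
  assumes l: "l \<ge> 1" and d: "d > 0"
    and bound: "\<And>x. log_path_densities x \<Longrightarrow> c * x l \<le> d * x k"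
  shows "c / d \<in> domination_exponents (path_graph k) (path_graph l)"
  unfolding domination_exponents_def
proof (intro CollectI allI impI)
  fix T :: "nat pair_pre_digraph"
  assume T: "pair_graph T \<and> pverts T \<noteq> {}"
  then interpret pair_graph T by simp
  have n: "card (pverts T) > 0" using T pair_finite_verts by (simp add: card_gt_0_iff)
  show "hom_density (path_graph k) T \<ge> hom_density (path_graph l) T powr (c / d)"
  proof (cases "parcs T = {}")
    case True
    then have "hom_density (path_graph l) T = 0"
      using l by (simp add: hom_density_path_graph pair_graph walk_count_eq_0)
    moreover have "hom_density (path_graph k) T \<ge> 0" by (simp add: hom_density_def)
    ultimately show ?thesis by simp
  next
    case False
    have pos: "hom_density (path_graph m) T > 0" for m
      using walk_count_pos[OF False, of m] n by (simp add: hom_density_path_graph pair_graph)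
    have "c * ln (hom_density (path_graph l) T) \<le> d * ln (hom_density (path_graph k) T)"
      using bound[OF log_path_densities[OF False]] .
    then have "c / d * ln (hom_density (path_graph l) T) \<le> ln (hom_density (path_graph k) T)"
      using d by (simp add: field_simps)
    then have "exp (c / d * ln (hom_density (path_graph l) T))
        \<le> exp (ln (hom_density (path_graph k) T))" by simp
    then show ?thesis using pos[of k] pos[of l] by (simp add: powr_def)
  qed
qed

section \<open>Lower bounds\<close>

lemma walk_count_le:
  assumes "pair_graph T"
  shows "walk_count T m \<le> card (pverts T) ^ Suc m"
proof (induction m)
  case 0
  then show ?case by (simp add: walk_count_def)
next
  case (Suc m)
  have "walk_count T (Suc m) \<le> walk_count T m * card (pverts T)"
    using pair_graph.walk_count_submult[OF assms, of m 0] pair_graph.walk_count_0[OF assms] by simp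
  also have "\<dots> \<le> card (pverts T) ^ Suc m * card (pverts T)"
    using Suc by (rule mult_le_mono1)
  finally show ?case by (simp add: mult.commute)
qed

text \<open>In the family \<open>T\<close>, the density of \<open>path_graph k\<close> is at most of
  order \<open>N\<close> to the \<open>-A\<close> and that of \<open>path_graph l\<close> at least
  of order \<open>N\<close> to the \<open>-B\<close>. As \<open>N\<close> grows, this rules out any
  exponent below \<open>A / B\<close>; the constants \<open>C\<close> and \<open>c\<close> do not
  matter.\<close>

lemma domination_exponent_ge:
  fixes T :: "nat \<Rightarrow> nat pair_pre_digraph" and A B C c k l :: nat
  assumes c': "c' \<in> domination_exponents (path_graph k) (path_graph l)"
    and T: "\<And>N. N \<ge> 1 \<Longrightarrow> pair_graph (T N)" "\<And>N. N \<ge> 1 \<Longrightarrow> pverts (T N) \<noteq> {}"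
    and upper: "\<And>N. N \<ge> 1 \<Longrightarrow> walk_count (T N) k * N ^ A \<le> C * card (pverts (T N)) ^ Suc k"
    and lower: "\<And>N. N \<ge> 1 \<Longrightarrow> card (pverts (T N)) ^ Suc l \<le> c * (walk_count (T N) l * N ^ B)"
    and pos: "A > 0" "B > 0" "C > 0" "c > 0"
  shows "real A / real B \<le> c'"
proof (rule ccontr)
  assume "\<not> real A / real B \<le> c'"
  \<comment> \<open>Replacing \<open>c'\<close> by its positive part keeps the inequality, because
    densities are at most 1, and makes \<open>powr d\<close> monotone in the base.\<close>
  define d where "d = max c' 0"
  have d: "d \<ge> 0" "c' \<le> d" "d < real A / real B"
    using \<open>\<not> real A / real B \<le> c'\<close> pos by (auto simp: d_def)
  define e where "e = real A - real B * d"
  have e: "e > 0" using d(3) pos by (simp add: e_def field_simps)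
  define M where "M = real C * real c powr d"
  have M: "M > 0" using pos by (simp add: M_def)
  have bound: "real N powr e \<le> M" if N: "N \<ge> 1" for N
  proof -
    define n where "n = real (card (pverts (T N)))"
    define tk where "tk = hom_density (path_graph k) (T N)"
    define tl where "tl = hom_density (path_graph l) (T N)"
    note G = T(1)[OF N]
    have n: "n > 0"
      using T(2)[OF N] pair_fin_digraph.pair_finite_verts[of "T N"] G
      by (simp add: n_def card_gt_0_iff pair_graph_def pair_digraph_def)
    have tk_eq: "tk = real (walk_count (T N) k) / n ^ Suc k"
      and tl_eq: "tl = real (walk_count (T N) l) / n ^ Suc l"
      by (simp_all add: tk_def tl_def hom_density_path_graph[OF G] n_def)
    have "real (walk_count (T N) k * N ^ A) \<le> real (C * card (pverts (T N)) ^ Suc k)"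
      using upper[OF N] by (rule of_nat_mono)
    then have tk: "tk * real N ^ A \<le> C"
      using n by (simp add: tk_eq n_def field_simps)
    have "real (card (pverts (T N)) ^ Suc l) \<le> real (c * (walk_count (T N) l * N ^ B))"
      using lower[OF N] by (rule of_nat_mono)
    then have tl: "1 \<le> c * (tl * real N ^ B)"
      using n by (simp add: tl_eq n_def field_simps)
    have tl_pos: "tl > 0"
    proof -
      have "tl \<ge> 0" by (simp add: tl_def hom_density_def)
      moreover have "tl \<noteq> 0" using tl by auto
      ultimately show ?thesis by simp
    qed
    have "real (walk_count (T N) l) \<le> real (card (pverts (T N)) ^ Suc l)"
      using walk_count_le[OF G] by (rule of_nat_mono)
    then have tl_le: "tl \<le> 1" using n by (simp add: tl_eq n_def)
    have "tl powr d \<le> tl powr c'"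
      using tl_pos tl_le d(2) by (intro powr_mono') auto
    also have "\<dots> \<le> tk"
      using c' G T(2)[OF N] by (auto simp: domination_exponents_def tk_def tl_def)
    finally have tkl: "tl powr d \<le> tk" .
    have "1 = 1 powr d" by simp
    also have "1 powr d \<le> (c * (tl * real N ^ B)) powr d"
      using tl d(1) by (intro powr_mono2) auto
    also have "\<dots> = real c powr d * tl powr d * real N powr (real B * d)"
      using tl_pos N by (simp add: powr_mult powr_realpow[symmetric] powr_powr)
    also have "\<dots> \<le> real c powr d * tk * real N powr (real B * d)"
      using tkl by (intro mult_left_mono mult_right_mono) auto
    finally have "1 * real N powr e \<le> real c powr d * tk * real N powr (real B * d) * real N powr e"
      by (intro mult_right_mono) auto
    also have "\<dots> = real c powr d * (tk * real N ^ A)"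
      using N by (simp add: e_def powr_add[symmetric] powr_realpow[symmetric] mult.assoc)
    also have "\<dots> \<le> real c powr d * C" using tk by (intro mult_left_mono) auto
    finally show ?thesis by (simp add: M_def mult.commute)
  qed
  obtain N :: nat where N: "real N > max 1 (M powr (1 / e))" using reals_Archimedean2 by blast
  have "M = (M powr (1 / e)) powr e" using M e by (simp add: powr_powr)
  also have "\<dots> < real N powr e" using N M e by (intro powr_less_mono2) auto
  also have "\<dots> \<le> M" using N by (intro bound) simp
  finally show False by simp
qed

section \<open>Layered graphs and their walk counts\<close>

text \<open>
  Layer \<open>i\<close> has \<open>s i\<close> vertices; matching residues modulo \<open>q i\<close> join the layers \<open>i\<close> and
  \<open>i + 1\<close> biregularly with density \<open>1 / q i\<close> once \<open>q i\<close> divides both sizes.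
\<close>

definition layered_graph :: "(nat \<Rightarrow> nat) \<Rightarrow> (nat \<Rightarrow> nat) \<Rightarrow> nat pair_pre_digraph" where
  "layered_graph s q =
    \<lparr> pverts = prod_encode ` {(i, x). x < s i},
      parcs = {(prod_encode (i, x), prod_encode (j, y)) | i x j y. x < s i \<and> y < s j \<and>
        (j = Suc i \<and> y mod q i = x mod q i \<or> i = Suc j \<and> y mod q j = x mod q j)} \<rparr>"

text \<open>By biregularity all vertices of layer \<open>i\<close> start equally many
  \<open>m\<close>-walks; the recursion computes this number, each quotient being the number of
  neighbours in an adjacent layer.\<close>

primrec layer_walks :: "(nat \<Rightarrow> nat) \<Rightarrow> (nat \<Rightarrow> nat) \<Rightarrow> nat \<Rightarrow> nat \<Rightarrow> nat" where
  "layer_walks s q 0 i = 1"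
| "layer_walks s q (Suc m) i = s (Suc i) div q i * layer_walks s q m (Suc i)
    + (case i of 0 \<Rightarrow> 0 | Suc j \<Rightarrow> s j div q j * layer_walks s q m j)"

lemma card_residue_class:
  fixes q t x :: nat
  assumes "q > 0" "q dvd t"
  shows "card {y. y < t \<and> y mod q = x mod q} = t div q"
proof -
  obtain z where t: "t = q * z" using assms(2) by (elim dvdE)
  have "{y. y < t \<and> y mod q = x mod q} = (\<lambda>w. q * w + x mod q) ` {..<z}"
  proof (intro equalityI subsetI)
    fix y assume y: "y \<in> {y. y < t \<and> y mod q = x mod q}"
    then have "y div q < z" using t assms(1) by (simp add: div_less_iff_less_mult mult.commute)
    moreover have "y = q * (y div q) + x mod q" using y by (metis (mono_tags) mem_Collect_eq mult_div_mod_eq)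
    ultimately show "y \<in> (\<lambda>w. q * w + x mod q) ` {..<z}" by blast
  next
    fix y assume "y \<in> (\<lambda>w. q * w + x mod q) ` {..<z}"
    then obtain w where w: "w < z" "y = q * w + x mod q" by blast
    have "q * w + x mod q < q * Suc w" using assms(1) by simp
    also have "\<dots> \<le> q * z" using w(1) by (intro mult_le_mono2) simp
    finally show "y \<in> {y. y < t \<and> y mod q = x mod q}" using w t by simp
  qed
  moreover have "inj_on (\<lambda>w. q * w + x mod q) {..<z}" using assms(1) by (auto simp: inj_on_def)
  ultimately show ?thesis using assms(1) by (simp add: card_image t)
qed

locale layers =
  fixes s q :: "nat \<Rightarrow> nat" and h :: nat
  assumes s_eq_0: "i > h \<Longrightarrow> s i = 0"
    and q_pos: "q i > 0"
    and q_dvd: "q i dvd s i" "q i dvd s (Suc i)"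
begin

lemma layered_verts: "{(i, x). x < s i} = Sigma {..h} (\<lambda>i. {..<s i})"
  using s_eq_0 by (force simp: not_less[symmetric])

lemma pair_graph_layered: "pair_graph (layered_graph s q)"
proof
  have fin: "finite (pverts (layered_graph s q))"
    unfolding layered_graph_def layered_verts by simp
  then show "finite (pverts (layered_graph s q))" .
  have "parcs (layered_graph s q) \<subseteq> pverts (layered_graph s q) \<times> pverts (layered_graph s q)"
    by (auto simp: layered_graph_def)
  then show "finite (parcs (layered_graph s q))"
    by (rule finite_subset) (intro finite_SigmaI fin)
  show "symmetric (layered_graph s q)"
    unfolding symmetric_def sym_def layered_graph_def by auto
qed (auto simp: layered_graph_def)

lemma card_layered_verts: "card (pverts (layered_graph s q)) = (\<Sum>i\<le>h. s i)"
  unfolding layered_graph_def layered_verts by (simp add: card_image inj_on_def)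

lemma walks_from_layered:
  assumes "x < s i"
  shows "walks_from (layered_graph s q) m (prod_encode (i, x)) = layer_walks s q m i"
  using assms
proof (induction m arbitrary: i x)
  case (Suc m)
  define U where "U = {y. y < s (Suc i) \<and> y mod q i = x mod q i}"
  define D where "D j = {y. y < s j \<and> y mod q j = x mod q j}" for j
  have fin: "finite U" "finite (D j)" for j by (auto simp: U_def D_def)
  have cards: "card U = s (Suc i) div q i" "i = Suc j \<Longrightarrow> card (D j) = s j div q j" for j
    unfolding U_def D_def using q_pos q_dvd by (auto intro!: card_residue_class)
  have nb: "{u. (prod_encode (i, x), u) \<in> parcs (layered_graph s q)}
    = (\<lambda>y. prod_encode (Suc i, y)) ` U
      \<union> (case i of 0 \<Rightarrow> {} | Suc j \<Rightarrow> (\<lambda>y. prod_encode (j, y)) ` D j)"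
    using Suc.prems by (auto simp: layered_graph_def U_def D_def split: nat.splits)
  have up: "(\<Sum>u\<in>(\<lambda>y. prod_encode (Suc i, y)) ` U. walks_from (layered_graph s q) m u)
      = s (Suc i) div q i * layer_walks s q m (Suc i)"
    unfolding cards(1)[symmetric]
    by (subst sum.reindex) (auto simp: inj_on_def Suc.IH U_def)
  have down: "(\<Sum>u\<in>(\<lambda>y. prod_encode (j, y)) ` D j. walks_from (layered_graph s q) m u)
      = s j div q j * layer_walks s q m j" if "i = Suc j" for j
    unfolding cards(2)[OF that, symmetric]
    by (subst sum.reindex) (auto simp: inj_on_def Suc.IH D_def)
  show ?case
  proof (cases i)
    case 0
    then show ?thesis unfolding walks_from.simps nb using up by simp
  next
    case (Suc j)
    have "walks_from (layered_graph s q) (Suc m) (prod_encode (i, x))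
      = (\<Sum>u\<in>(\<lambda>y. prod_encode (Suc i, y)) ` U. walks_from (layered_graph s q) m u)
      + (\<Sum>u\<in>(\<lambda>y. prod_encode (j, y)) ` D j. walks_from (layered_graph s q) m u)"
      unfolding walks_from.simps nb by (simp only: Suc nat.case, subst sum.union_disjoint) (use fin in auto)
    then show ?thesis using up down[OF Suc] by (simp add: Suc)
  qed
qed simp

lemma walk_count_layered: "walk_count (layered_graph s q) m = (\<Sum>i\<le>h. s i * layer_walks s q m i)"
proof -
  have "walk_count (layered_graph s q) m
      = (\<Sum>(i, x)\<in>Sigma {..h} (\<lambda>i. {..<s i}). walks_from (layered_graph s q) m (prod_encode (i, x)))"
    unfolding walk_count_def layered_graph_def pair_pre_digraph.simps layered_verts
    by (subst sum.reindex) (auto simp: inj_on_def intro!: sum.cong)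
  also have "\<dots> = (\<Sum>i\<le>h. \<Sum>x<s i. walks_from (layered_graph s q) m (prod_encode (i, x)))"
    by (subst sum.Sigma) auto
  also have "\<dots> = (\<Sum>i\<le>h. s i * layer_walks s q m i)"
    by (intro sum.cong refl) (simp add: walks_from_layered)
  finally show ?thesis .
qed

end

lemma domination_exponent_ge_layered:
  fixes s q :: "nat \<Rightarrow> nat \<Rightarrow> nat" and A B C c k l :: nat
  assumes c': "c' \<in> domination_exponents (path_graph k) (path_graph l)"
    and layers: "\<And>N. N \<ge> 1 \<Longrightarrow> layers (s N) (q N) h"
    and ne: "\<And>N. N \<ge> 1 \<Longrightarrow> (\<Sum>i\<le>h. s N i) > 0"
    and upper: "\<And>N. N \<ge> 1 \<Longrightarrow>
      (\<Sum>i\<le>h. s N i * layer_walks (s N) (q N) k i) * N ^ A \<le> C * (\<Sum>i\<le>h. s N i) ^ Suc k"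
    and lower: "\<And>N. N \<ge> 1 \<Longrightarrow>
      (\<Sum>i\<le>h. s N i) ^ Suc l \<le> c * ((\<Sum>i\<le>h. s N i * layer_walks (s N) (q N) l i) * N ^ B)"
    and pos: "A > 0" "B > 0" "C > 0" "c > 0"
  shows "real A / real B \<le> c'"
proof (rule domination_exponent_ge[where T = "\<lambda>N. layered_graph (s N) (q N)", OF c' _ _ _ _ pos])
  fix N :: nat
  assume N: "N \<ge> 1"
  interpret layers "s N" "q N" h using layers[OF N] .
  show "pair_graph (layered_graph (s N) (q N))" by (rule pair_graph_layered)
  show "pverts (layered_graph (s N) (q N)) \<noteq> {}"
    using ne[OF N] card_layered_verts by (metis card.empty less_irrefl)
  show "walk_count (layered_graph (s N) (q N)) k * N ^ A
      \<le> C * card (pverts (layered_graph (s N) (q N))) ^ Suc k"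
    unfolding walk_count_layered card_layered_verts by (rule upper[OF N])
  show "card (pverts (layered_graph (s N) (q N))) ^ Suc l
      \<le> c * (walk_count (layered_graph (s N) (q N)) l * N ^ B)"
    unfolding walk_count_layered card_layered_verts by (rule lower[OF N])
qed

section \<open>Matching, star and single edge as targets\<close>

text \<open>The target is a perfect matching with \<open>N\<close> edges: every walk is determined
  by its start, so a path with \<open>m\<close> edges has density \<open>(2 * N)\<close> to the
  \<open>-m\<close>.\<close>

lemma exponent_ge_matching:
  assumes "c' \<in> domination_exponents (path_graph k) (path_graph l)" "k \<ge> 1" "l \<ge> 1"
  shows "real k / real l \<le> c'"
proof -
  define s :: "nat \<Rightarrow> nat \<Rightarrow> nat" where "s N i = (if i \<le> 1 then N else 0)" for N i
  define q :: "nat \<Rightarrow> nat \<Rightarrow> nat" where "q N i = (if i \<le> 1 then N else 1)" for N i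
  have walks: "layer_walks (s N) (q N) m 0 = 1 \<and> layer_walks (s N) (q N) m (Suc 0) = 1"
    if "N \<ge> 1" for N m
    using that by (induction m) (auto simp: s_def q_def)
  show ?thesis
  proof (rule domination_exponent_ge_layered[where s = s and q = q and h = 1 and C = 1 and c = "2 ^ l"])
    fix N :: nat assume N: "N \<ge> 1"
    show "layers (s N) (q N) 1"
      by standard (use N in \<open>auto simp: s_def q_def\<close>)
    have n: "(\<Sum>i\<le>1. s N i) = 2 * N" by (simp add: s_def)
    have w: "(\<Sum>i\<le>1. s N i * layer_walks (s N) (q N) m i) = 2 * N" for m
      using walks[OF N, of m] by (simp add: s_def)
    show "(\<Sum>i\<le>1. s N i) > 0" unfolding n using N by simp
    have "2 * N * N ^ k \<le> 2 * N * (2 * N) ^ k" by (intro mult_le_mono2 power_mono) auto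
    then show "(\<Sum>i\<le>1. s N i * layer_walks (s N) (q N) k i) * N ^ k \<le> 1 * (\<Sum>i\<le>1. s N i) ^ Suc k"
      unfolding n w by simp
    show "(\<Sum>i\<le>1. s N i) ^ Suc l \<le> 2 ^ l * ((\<Sum>i\<le>1. s N i * layer_walks (s N) (q N) l i) * N ^ l)"
      unfolding n w by (simp add: power_mult_distrib)
  qed (use assms in auto)
qed

text \<open>The target is a star with \<open>N\<close> leaves in layer 0 and its centre in layer 1.
  With \<open>k = 2 * p + 1\<close> and \<open>l = 2 * r\<close>, the densities have orders
  \<open>N\<close> to the \<open>-(p + 1)\<close> and \<open>N\<close> to the \<open>-r\<close>; the
  best walks for even \<open>l\<close> start and end at leaves.\<close>

lemma exponent_ge_star:
  assumes "c' \<in> domination_exponents (path_graph k) (path_graph l)" "odd k" "even l" "l \<ge> 1"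
  shows "(real k + 1) / real l \<le> c'"
proof -
  obtain p where k: "k = 2 * p + 1" using assms(2) by (elim oddE)
  obtain r where l: "l = 2 * r" using assms(3) by (elim evenE)
  define s :: "nat \<Rightarrow> nat \<Rightarrow> nat"
    where "s N i = (if i = 0 then N else if i = 1 then 1 else 0)" for N i
  define q :: "nat \<Rightarrow> nat \<Rightarrow> nat" where "q N i = 1" for N i
  have ev: "layer_walks (s N) (q N) (2 * m) 0 = N ^ m \<and> layer_walks (s N) (q N) (2 * m) (Suc 0) = N ^ m"
    for N m
    by (induction m) (auto simp: s_def q_def)
  have od: "layer_walks (s N) (q N) (2 * m + 1) 0 = N ^ m"
    "layer_walks (s N) (q N) (2 * m + 1) (Suc 0) = N ^ Suc m" for N m
    using ev[of N m] by (auto simp: s_def q_def)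
  have "real (p + 1) / real r \<le> c'"
  proof (rule domination_exponent_ge_layered[where s = s and q = q and h = 1 and C = 2
        and c = "2 ^ Suc l", OF assms(1)])
    fix N :: nat assume N: "N \<ge> 1"
    show "layers (s N) (q N) 1"
      by standard (auto simp: s_def q_def)
    have n: "(\<Sum>i\<le>1. s N i) = N + 1" by (simp add: s_def)
    have wk: "(\<Sum>i\<le>1. s N i * layer_walks (s N) (q N) k i) = 2 * N ^ (p + 1)"
      using od[of N p] by (simp add: s_def k)
    have wl: "(\<Sum>i\<le>1. s N i * layer_walks (s N) (q N) l i) \<ge> N ^ (r + 1)"
      using ev[of N r] by (simp add: s_def l)
    show "(\<Sum>i\<le>1. s N i) > 0" unfolding n by simp
    have exps: "Suc k = (p + 1) + (p + 1)" "Suc l = (r + 1) + r" by (auto simp: k l)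
    have "2 * N ^ (p + 1) * N ^ (p + 1) = 2 * N ^ Suc k"
      unfolding exps by (simp only: power_add mult.assoc)
    also have "\<dots> \<le> 2 * (N + 1) ^ Suc k" by (intro mult_le_mono2 power_mono) auto
    finally show "(\<Sum>i\<le>1. s N i * layer_walks (s N) (q N) k i) * N ^ (p + 1) \<le> 2 * (\<Sum>i\<le>1. s N i) ^ Suc k"
      unfolding n wk .
    have "(N + 1) ^ Suc l \<le> (2 * N) ^ Suc l" using N by (intro power_mono) auto
    also have "\<dots> = 2 ^ Suc l * (N ^ (r + 1) * N ^ r)"
      unfolding power_mult_distrib exps by (simp only: power_add mult.assoc)
    also have "\<dots> \<le> 2 ^ Suc l * ((\<Sum>i\<le>1. s N i * layer_walks (s N) (q N) l i) * N ^ r)"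
      by (intro mult_le_mono2 mult_le_mono1 wl)
    finally show "(\<Sum>i\<le>1. s N i) ^ Suc l
        \<le> 2 ^ Suc l * ((\<Sum>i\<le>1. s N i * layer_walks (s N) (q N) l i) * N ^ r)"
      unfolding n .
  qed (use assms l in auto)
  moreover have "(real k + 1) / real l = real (p + 1) / real r"
    using assms(4) by (simp add: k l field_simps)
  ultimately show ?thesis by simp
qed

text \<open>A single edge and \<open>N\<close> isolated vertices; the empty layer 2 keeps layer 3 isolated.\<close>

lemma exponent_ge_edge:
  assumes "c' \<in> domination_exponents (path_graph k) (path_graph l)" "k \<ge> 1" "l \<ge> 1"
  shows "(real k + 1) / (real l + 1) \<le> c'"
proof -
  define s :: "nat \<Rightarrow> nat \<Rightarrow> nat"
    where "s N i = (if i \<le> 1 then 1 else if i = 3 then N else 0)" for N i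
  define q :: "nat \<Rightarrow> nat \<Rightarrow> nat" where "q N i = 1" for N i
  have walks: "layer_walks (s N) (q N) m 0 = 1 \<and> layer_walks (s N) (q N) m (Suc 0) = 1" for N m
    by (induction m) (auto simp: s_def q_def)
  have iso: "layer_walks (s N) (q N) m 3 = 0" if "m \<ge> 1" for N m
    using that by (cases m) (auto simp: s_def q_def numeral_3_eq_3)
  \<comment> \<open>The number of walks stays at 2, so each density decays with the number of path
    vertices as exponent.\<close>
  have "real (Suc k) / real (Suc l) \<le> c'"
  proof (rule domination_exponent_ge_layered[where s = s and q = q and h = 3 and C = 2
        and c = "3 ^ Suc l", OF assms(1)])
    fix N :: nat assume N: "N \<ge> 1"
    show "layers (s N) (q N) 3"
      by standard (auto simp: s_def q_def)
    have n: "(\<Sum>i\<le>3. s N i) = N + 2" by (simp add: s_def numeral_3_eq_3)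
    have w: "(\<Sum>i\<le>3. s N i * layer_walks (s N) (q N) m i) = 2" if "m \<ge> 1" for m
      using walks[of N m] iso[OF that, of N] by (simp add: s_def numeral_3_eq_3)
    show "(\<Sum>i\<le>3. s N i) > 0" unfolding n by simp
    show "(\<Sum>i\<le>3. s N i * layer_walks (s N) (q N) k i) * N ^ Suc k \<le> 2 * (\<Sum>i\<le>3. s N i) ^ Suc k"
      unfolding n w[OF assms(2)] by (intro mult_le_mono2 power_mono) auto
    have "(N + 2) ^ Suc l \<le> (3 * N) ^ Suc l" using N by (intro power_mono) auto
    also have "\<dots> \<le> 3 ^ Suc l * (2 * N ^ Suc l)"
      unfolding power_mult_distrib by (intro mult_le_mono2) simp
    finally show "(\<Sum>i\<le>3. s N i) ^ Suc l
        \<le> 3 ^ Suc l * ((\<Sum>i\<le>3. s N i * layer_walks (s N) (q N) l i) * N ^ Suc l)"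
      unfolding n w[OF assms(3)] .
  qed auto
  then show ?thesis by (simp add: add.commute)
qed

section \<open>The construction for odd \<open>k\<close> and odd \<open>l\<close>\<close>

text \<open>
  The layer sizes of the odd-odd construction are \<open>N\<^bsup>D - 2 f i\<^esup>\<close>. The function \<open>f\<close> increases by one
  every \<open>2 K = k + 1\<close> vertices, from the left end on even vertices and from the right end on odd ones.
\<close>

lemma level_function:
  fixes K \<rho> a l :: nat
  assumes \<rho>: "\<rho> < K" and l: "l = 2 * (a * K + \<rho>) + 1"
  obtains f :: "nat \<Rightarrow> nat"
  where "f 0 = 0" "f l = 0" "\<And>i. i < l \<Longrightarrow> f i + f (Suc i) \<le> a + 1"
    "\<And>u v. u \<le> l \<Longrightarrow> v \<le> l \<Longrightarrow> odd (u + v) \<Longrightarrow> u < v + 2 * K \<Longrightarrow> v < u + 2 * K \<Longrightarrow> a \<le> f u + f v"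
proof -
  \<comment> \<open>\<open>\<alpha>\<close> and \<open>\<beta>\<close> are half the distances from
    the two ends to the first increase of \<open>f\<close>. Lying between 1 and \<open>K\<close>,
    they give \<open>f 0 = f l = 0\<close>; their sum \<open>\<rho> + 2\<close> suits the rounding
    in both bounds below.\<close>
  define \<alpha> where "\<alpha> = 1 + \<rho> div 2"
  define \<beta> where "\<beta> = \<rho> + 2 - \<alpha>"
  have \<alpha>\<beta>: "\<alpha> + \<beta> = \<rho> + 2" "1 \<le> \<alpha>" "\<alpha> \<le> K" "1 \<le> \<beta>" "\<beta> \<le> K"
    using \<rho> by (auto simp: \<alpha>_def \<beta>_def)
  define f where
    "f u = (if even u then (u div 2 + K - \<alpha>) div K else ((l - u) div 2 + K - \<beta>) div K)" for u
  have fe: "f (2 * i) = (i + K - \<alpha>) div K" for i by (simp add: f_def)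
  have fo: "f v = (j + K - \<beta>) div K" if "v + 2 * j = l" for v j
  proof -
    have "odd v" using that l by presburger
    moreover have "(l - v) div 2 = j" using that by auto
    ultimately show ?thesis by (simp add: f_def)
  qed
  have division: "K * (x div K) \<le> x" "x < K * (x div K) + K" for x
    using \<rho> dividend_less_times_div[of K x] by auto
  \<comment> \<open>\<open>i\<close> and \<open>j\<close> are half the distances of
    \<open>2 * i\<close> from the left end and of \<open>v\<close> from the right end; for
    neighbours they sum to \<open>a * K + \<rho>\<close> or one more.\<close>
  have upper: "f (2 * i) + f v \<le> a + 1" if "v + 2 * j = l" "i + j \<le> a * K + \<rho> + 1" for i j v
  proof -
    have "K * (f (2 * i) + f v) \<le> (i + K - \<alpha>) + (j + K - \<beta>)"
      unfolding fe fo[OF that(1)] distrib_left by (intro add_mono division)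
    also have "\<dots> < K * (a + 2)" using that(2) \<alpha>\<beta> \<rho> by (simp add: algebra_simps)
    finally show ?thesis unfolding mult_less_cancel1 by simp
  qed
  have lower: "a \<le> f (2 * i) + f v" if "v + 2 * j = l" "a * K + \<rho> < i + j + K" for i j v
  proof -
    \<comment> \<open>The summand 2 pays for the two strict inequalities in
      \<open>division(2)\<close>.\<close>
    have "K * a + (K + K) < (i + K - \<alpha>) + (j + K - \<beta>) + 2 + K"
      using that(2) \<alpha>\<beta> by (simp add: mult.commute)
    also have "\<dots> \<le> (K * f (2 * i) + K) + (K * f v + K) + K"
      using division(2)[of "i + K - \<alpha>"] division(2)[of "j + K - \<beta>"] unfolding fe fo[OF that(1)]
      by linarith
    finally have "K * a < K * (f (2 * i) + f v + 1)" by (simp add: distrib_left)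
    then show ?thesis unfolding mult_less_cancel1 by simp
  qed
  show thesis
  proof (rule that[of f])
    show "f 0 = 0" using fe[of 0] \<alpha>\<beta> by simp
    show "f l = 0" using fo[of l 0] \<alpha>\<beta> by simp
    show "f i + f (Suc i) \<le> a + 1" if i: "i < l" for i
    proof (cases "even i")
      case True
      then obtain j where j: "i = 2 * j" by (elim evenE)
      have "Suc i + 2 * (a * K + \<rho> - j) = l" using i by (simp add: j l)
      from upper[OF this, of j] show ?thesis using i by (simp add: j l)
    next
      case False
      then obtain j where j: "i = 2 * j + 1" by (elim oddE)
      have "i + 2 * (a * K + \<rho> - j) = l" using i by (simp add: j l)
      from upper[OF this, of "Suc j"] show ?thesis using i by (simp add: j l)
    qed
    have main: "a \<le> f u + f v"
      if uv: "v \<le> l" "even u" "odd v" "v < u + 2 * K" for u v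
    proof -
      obtain i where i: "u = 2 * i" using uv(2) by (elim evenE)
      obtain j where j: "v = 2 * j + 1" using uv(3) by (elim oddE)
      have "v + 2 * (a * K + \<rho> - j) = l" using uv(1) by (simp add: j l)
      from lower[OF this, of i] show ?thesis using uv by (simp add: i j l)
    qed
    show "a \<le> f u + f v"
      if "u \<le> l" "v \<le> l" "odd (u + v)" "u < v + 2 * K" "v < u + 2 * K" for u v
    proof (cases "even u")
      case True
      then show ?thesis using that by (intro main) auto
    next
      case False
      then show ?thesis using that main[of u v] by (simp add: add.commute)
    qed
  qed
qed

text \<open>A vertex of layer \<open>u\<close> has \<open>N\<close> to the
  \<open>\<delta> + f u - f w\<close> neighbours in an adjacent layer \<open>w\<close>. These
  exponents telescope: the \<open>m\<close>-walks along a layer sequence from \<open>u\<close> to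
  \<open>v\<close> number \<open>N\<close> to the \<open>D + m * \<delta> - f u - f v\<close>. The
  straight \<open>l\<close>-walks lose nothing, as \<open>f\<close> vanishes at both ends, while by
  \<open>walk\<close> every \<open>k\<close>-walk loses at least \<open>a\<close>.\<close>

lemma exponent_ge_layers:
  fixes f :: "nat \<Rightarrow> nat"
  assumes c': "c' \<in> domination_exponents (path_graph k) (path_graph l)" and kl: "k \<ge> 1" "l \<ge> 1"
    and f: "f 0 = 0" "f l = 0" "\<And>i. i < l \<Longrightarrow> f i + f (Suc i) \<le> a + 1"
    and walk: "\<And>u v. u \<le> l \<Longrightarrow> v \<le> l \<Longrightarrow> even (u + v + k) \<Longrightarrow> u \<le> v + k \<Longrightarrow> v \<le> u + k \<Longrightarrow> a \<le> f u + f v"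
  shows "real (k * (a + 1) + a) / real (l * (a + 1)) \<le> c'"
proof -
  \<comment> \<open>Since \<open>f i \<le> a + 1\<close>, this \<open>D\<close> keeps all natural
    subtractions exact; \<open>\<delta> = D - (a + 1)\<close> is the mean degree exponent of the two
    directions of an edge.\<close>
  define D where "D = 2 * a + 3"
  define \<delta> where "\<delta> = a + 2"
  define s :: "nat \<Rightarrow> nat \<Rightarrow> nat" where "s N i = (if i \<le> l then N ^ (D - 2 * f i) else 0)" for N i
  define q :: "nat \<Rightarrow> nat \<Rightarrow> nat"
    where "q N i = (if i < l then N ^ (a + 1 - (f i + f (Suc i))) else 1)" for N i
  have fle: "f i \<le> a + 1" if "i \<le> l" for i
    using f(3)[of i] f(2) that by (cases "i = l") auto
  have up: "s N (Suc i) div q N i = N ^ (\<delta> + f i - f (Suc i))" if "i < l" "N \<ge> 1" for N i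
  proof -
    have "D - 2 * f (Suc i) = (\<delta> + f i - f (Suc i)) + (a + 1 - (f i + f (Suc i)))"
      using f(3)[OF that(1)] by (simp add: D_def \<delta>_def)
    then show ?thesis using that by (simp add: s_def q_def power_add)
  qed
  have down: "s N i div q N i = N ^ (\<delta> + f (Suc i) - f i)" if "i < l" "N \<ge> 1" for N i
  proof -
    have "D - 2 * f i = (\<delta> + f (Suc i) - f i) + (a + 1 - (f i + f (Suc i)))"
      using f(3)[OF that(1)] by (simp add: D_def \<delta>_def)
    then show ?thesis using that by (simp add: s_def q_def power_add)
  qed
  \<comment> \<open>\<open>p\<close> bounds \<open>f\<close> from below on every layer that an
    \<open>m\<close>-walk from layer \<open>u\<close> can reach, given distance and parity;
    \<open>2 ^ m\<close> counts the choices of direction.\<close>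
  have upper: "layer_walks (s N) (q N) m u * N ^ p \<le> 2 ^ m * N ^ (m * \<delta> + f u)"
    if "N \<ge> 1" "u \<le> l"
      "\<And>v. v \<le> l \<Longrightarrow> even (u + v + m) \<Longrightarrow> u \<le> v + m \<Longrightarrow> v \<le> u + m \<Longrightarrow> p \<le> f v" for N m p u
    using that(2,3)
  proof (induction m arbitrary: u)
    case 0
    then have "p \<le> f u" by simp
    then show ?case using that(1) by (simp add: power_increasing)
  next
    case (Suc m)
    have step: "N ^ (\<delta> + f u - f w) * (layer_walks (s N) (q N) m w * N ^ p)
        \<le> 2 ^ m * N ^ (Suc m * \<delta> + f u)"
      if w: "w \<le> l" "w = Suc u \<or> u = Suc w" for w
    proof -
      have "layer_walks (s N) (q N) m w * N ^ p \<le> 2 ^ m * N ^ (m * \<delta> + f w)"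
        using w by (intro Suc.IH Suc.prems(2)) auto
      then have "N ^ (\<delta> + f u - f w) * (layer_walks (s N) (q N) m w * N ^ p)
          \<le> N ^ (\<delta> + f u - f w) * (2 ^ m * N ^ (m * \<delta> + f w))" by (rule mult_le_mono2)
      also have "\<dots> = 2 ^ m * N ^ ((\<delta> + f u - f w) + (m * \<delta> + f w))" by (simp add: power_add)
      also have "(\<delta> + f u - f w) + (m * \<delta> + f w) = Suc m * \<delta> + f u"
        using fle[OF w(1)] by (simp add: \<delta>_def)
      finally show ?thesis .
    qed
    have 1: "s N (Suc u) div q N u * layer_walks (s N) (q N) m (Suc u) * N ^ p
        \<le> 2 ^ m * N ^ (Suc m * \<delta> + f u)"
    proof (cases "u < l")
      case True
      then show ?thesis using step[of "Suc u"] up[OF True that(1)] by (simp add: mult.assoc)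
    next
      case False
      then show ?thesis by (simp add: s_def)
    qed
    have 2: "(case u of 0 \<Rightarrow> 0 | Suc w \<Rightarrow> s N w div q N w * layer_walks (s N) (q N) m w) * N ^ p
        \<le> 2 ^ m * N ^ (Suc m * \<delta> + f u)"
    proof (cases u)
      case (Suc w)
      then show ?thesis using step[of w] down[of w N] Suc.prems(1) that(1) by (simp add: mult.assoc)
    qed simp
    show ?case using add_mono[OF 1 2] by (simp add: distrib_right)
  qed
  \<comment> \<open>Only walks running straight to the last layer \<open>l\<close> are counted, by
    induction on the remaining distance \<open>j\<close>.\<close>
  have lower: "N ^ (j * \<delta> + f (l - j)) \<le> layer_walks (s N) (q N) j (l - j)"
    if "N \<ge> 1" "j \<le> l" for N j
    using that(2)
  proof (induction j)
    case 0
    then show ?case by (simp add: f)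
  next
    case (Suc j)
    define i where "i = l - Suc j"
    have i: "Suc i = l - j" "i < l" using Suc.prems by (auto simp: i_def)
    have "Suc j * \<delta> + f i = (\<delta> + f i - f (Suc i)) + (j * \<delta> + f (Suc i))"
      using fle[of "Suc i"] i(2) by (simp add: \<delta>_def)
    then have "N ^ (Suc j * \<delta> + f i) = N ^ (\<delta> + f i - f (Suc i)) * N ^ (j * \<delta> + f (Suc i))"
      by (simp only: power_add[symmetric])
    also have "\<dots> \<le> N ^ (\<delta> + f i - f (Suc i)) * layer_walks (s N) (q N) j (Suc i)"
      using Suc by (intro mult_le_mono2) (simp add: i)
    also have "\<dots> \<le> layer_walks (s N) (q N) (Suc j) i"
      using up[OF i(2) that(1)] by simp
    finally show ?case by (simp add: i_def)
  qed
  show ?thesis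
  proof (rule domination_exponent_ge_layered[where s = s and q = q and h = l
        and C = "Suc l * 2 ^ k" and c = "Suc l ^ Suc l", OF c'])
    fix N :: nat assume N: "N \<ge> 1"
    show "layers (s N) (q N) l"
    proof
      fix i
      show "s N i = 0" if "i > l" using that by (simp add: s_def)
      show "q N i > 0" using N by (simp add: q_def)
      have "q N i dvd s N i \<and> q N i dvd s N (Suc i)"
      proof (cases "i < l")
        case True
        have "a + 1 - (f i + f (Suc i)) \<le> D - 2 * f i" "a + 1 - (f i + f (Suc i)) \<le> D - 2 * f (Suc i)"
          using f(3)[OF True] by (auto simp: D_def)
        then show ?thesis using True by (auto simp: q_def s_def intro!: le_imp_power_dvd)
      qed (simp add: q_def)
      then show "q N i dvd s N i" "q N i dvd s N (Suc i)" by auto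
    qed
    define n where "n = (\<Sum>i\<le>l. s N i)"
    have n_ge: "N ^ D \<le> n"
      unfolding n_def using member_le_sum[of 0 "{..l}" "s N"] by (simp add: s_def f)
    have "n \<le> (\<Sum>i\<le>l. N ^ D)"
      unfolding n_def using N by (intro sum_mono) (auto simp: s_def intro!: power_increasing)
    then have n_le: "n \<le> Suc l * N ^ D" by simp
    show "(\<Sum>i\<le>l. s N i) > 0" 
      using n_ge N unfolding n_def by (meson less_le_trans less_numeral_extra(1) one_le_power order.trans)
    have summand: "s N u * layer_walks (s N) (q N) k u * N ^ a \<le> 2 ^ k * N ^ (D + k * \<delta>)"
      if u: "u \<le> l" for u
    proof -
      have walks: "layer_walks (s N) (q N) k u * N ^ (a - f u) \<le> 2 ^ k * N ^ (k * \<delta> + f u)"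
      proof (rule upper[OF N u])
        fix v assume "v \<le> l" "even (u + v + k)" "u \<le> v + k" "v \<le> u + k"
        then have "a \<le> f u + f v" using u by (intro walk)
        then show "a - f u \<le> f v" by simp
      qed
      \<comment> \<open>An inequality only, because \<open>a - f u\<close> is truncated when
        \<open>f u\<close> exceeds \<open>a\<close>.\<close>
      have "N ^ a \<le> N ^ (a - f u) * N ^ f u"
        unfolding power_add[symmetric] using N by (intro power_increasing) auto
      then have "s N u * layer_walks (s N) (q N) k u * N ^ a
          \<le> s N u * layer_walks (s N) (q N) k u * (N ^ (a - f u) * N ^ f u)"
        by (rule mult_le_mono2)
      also have "\<dots> = s N u * (layer_walks (s N) (q N) k u * N ^ (a - f u)) * N ^ f u"
        by (simp only: mult_ac)
      also have "\<dots> \<le> s N u * (2 ^ k * N ^ (k * \<delta> + f u)) * N ^ f u"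
        by (intro mult_le_mono1 mult_le_mono2 walks)
      also have "\<dots> = 2 ^ k * N ^ ((D - 2 * f u) + (k * \<delta> + f u) + f u)"
        using u by (simp add: s_def power_add)
      also have "(D - 2 * f u) + (k * \<delta> + f u) + f u = D + k * \<delta>"
        using fle[OF u] by (simp add: D_def)
      finally show ?thesis .
    qed
    have exps: "D + m * \<delta> + m * (a + 1) = D * Suc m" for m
      by (simp add: D_def \<delta>_def algebra_simps)
    have "(\<Sum>i\<le>l. s N i * layer_walks (s N) (q N) k i) * N ^ (k * (a + 1) + a)
        = (\<Sum>i\<le>l. s N i * layer_walks (s N) (q N) k i * N ^ a) * N ^ (k * (a + 1))"
      unfolding sum_distrib_right[symmetric] by (simp only: power_add mult_ac)
    also have "\<dots> \<le> (\<Sum>i\<le>l. 2 ^ k * N ^ (D + k * \<delta>)) * N ^ (k * (a + 1))"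
      using summand by (intro mult_le_mono1 sum_mono) auto
    also have "\<dots> = Suc l * 2 ^ k * N ^ (D + k * \<delta> + k * (a + 1))"
      by (simp add: power_add algebra_simps)
    also have "\<dots> = Suc l * 2 ^ k * (N ^ D) ^ Suc k"
      unfolding exps by (simp only: power_mult)
    also have "\<dots> \<le> Suc l * 2 ^ k * n ^ Suc k"
      using n_ge by (intro mult_le_mono2 power_mono) auto
    finally show "(\<Sum>i\<le>l. s N i * layer_walks (s N) (q N) k i) * N ^ (k * (a + 1) + a)
        \<le> Suc l * 2 ^ k * (\<Sum>i\<le>l. s N i) ^ Suc k"
      unfolding n_def .
    have "N ^ (D + l * \<delta>) \<le> s N 0 * layer_walks (s N) (q N) l 0"
      using lower[OF N, of l] by (simp add: s_def f power_add)
    also have "\<dots> \<le> (\<Sum>i\<le>l. s N i * layer_walks (s N) (q N) l i)"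
      by (rule member_le_sum) auto
    finally have wl: "N ^ (D + l * \<delta>) \<le> (\<Sum>i\<le>l. s N i * layer_walks (s N) (q N) l i)" .
    have "n ^ Suc l \<le> (Suc l * N ^ D) ^ Suc l" using n_le by (intro power_mono) auto
    also have "\<dots> = Suc l ^ Suc l * N ^ (D + l * \<delta> + l * (a + 1))"
      unfolding exps by (simp only: power_mult power_mult_distrib)
    also have "\<dots> = Suc l ^ Suc l * (N ^ (D + l * \<delta>) * N ^ (l * (a + 1)))"
      by (simp only: power_add)
    also have "\<dots> \<le> Suc l ^ Suc l *
        ((\<Sum>i\<le>l. s N i * layer_walks (s N) (q N) l i) * N ^ (l * (a + 1)))"
      by (intro mult_le_mono2 mult_le_mono1 wl)
    finally show "(\<Sum>i\<le>l. s N i) ^ Suc l \<le> Suc l ^ Suc l *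
        ((\<Sum>i\<le>l. s N i * layer_walks (s N) (q N) l i) * N ^ (l * (a + 1)))"
      unfolding n_def .
  qed (use kl in auto)
qed

text \<open>As \<open>k + 1 = 2 * K\<close> is even and \<open>l\<close> odd, the remainder is odd,
  \<open>r = 2 * \<rho> + 1\<close>, which is the form \<open>level_function\<close> expects. The
  numerator is \<open>(a + 1) * (k + 1) - 1\<close>, as in \<open>odd_odd_bound\<close>.\<close>

lemma odd_odd_exponent:
  assumes k: "odd k" and l: "odd l" and a: "a = l div (k + 1)"
  shows "has_domination_exponent (path_graph k) (path_graph l)
    (real (k * (a + 1) + a) / real (l * (a + 1)))"
proof -
  have k1: "k \<ge> 1" and l1: "l \<ge> 1" using k l by (auto elim: oddE)
  have "even (k + 1)" using k by simp
  then obtain K where K: "k + 1 = 2 * K" by (elim evenE)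
  define r where "r = l mod (k + 1)"
  have lr: "l = a * (k + 1) + r" unfolding a r_def by (rule div_mult_mod_eq[symmetric])
  have r: "r < 2 * K" unfolding r_def K[symmetric] by simp
  have "odd r" using l lr k by simp
  then obtain \<rho> where \<rho>: "r = 2 * \<rho> + 1" by (elim oddE)
  have \<rho>K: "\<rho> < K" using r \<rho> by simp
  have l_eq: "l = 2 * (a * K + \<rho>) + 1" using lr unfolding K \<rho> by simp
  have num: "real (Suc a * Suc k) - 1 = real (k * (a + 1) + a)" by (simp add: algebra_simps)
  have upper: "real (k * (a + 1) + a) / real (l * (a + 1))
      \<in> domination_exponents (path_graph k) (path_graph l)"
  proof (rule domination_exponentI[OF l1])
    show "real (l * (a + 1)) > 0" unfolding of_nat_0_less_iff using l1 by simp
    fix x assume "log_path_densities x"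
    then interpret log_path_densities x .
    have "r \<le> k" using r K by simp
    then have "l \<le> Suc a * Suc k - 1" by (subst lr) simp
    from odd_odd_bound[OF k l this]
    show "real (k * (a + 1) + a) * x l \<le> real (l * (a + 1)) * x k"
      unfolding num by (simp add: algebra_simps)
  qed
  obtain f :: "nat \<Rightarrow> nat" where f: "f 0 = 0" "f l = 0" "\<And>i. i < l \<Longrightarrow> f i + f (Suc i) \<le> a + 1"
    "\<And>u v. u \<le> l \<Longrightarrow> v \<le> l \<Longrightarrow> odd (u + v) \<Longrightarrow> u < v + 2 * K \<Longrightarrow> v < u + 2 * K \<Longrightarrow> a \<le> f u + f v"
    using level_function[OF \<rho>K l_eq] by metis
  have "real (k * (a + 1) + a) / real (l * (a + 1)) \<le> c'"
    if "c' \<in> domination_exponents (path_graph k) (path_graph l)" for c'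
  proof (rule exponent_ge_layers[OF that k1 l1 f(1-3)])
    \<comment> \<open>For odd \<open>k\<close> the end layers of a \<open>k\<close>-walk have
      opposite parity, and distance at most \<open>k\<close> means less than
      \<open>2 * K\<close>.\<close>
    fix u v assume "u \<le> l" "v \<le> l" "even (u + v + k)" "u \<le> v + k" "v \<le> u + k"
    then show "a \<le> f u + f v" using k K by (intro f(4)) auto
  qed
  with upper show ?thesis by (auto simp: has_domination_exponent_def)
qed

theorem theorem3p3:
  fixes k l :: nat
  assumes "k \<ge> 1" and "l \<ge> 1"
  shows
    "(k > l \<and> (even k \<or> (odd k \<and> odd l)) \<longrightarrow>
        has_domination_exponent (path_graph k) (path_graph l) (real k / real l)) \<and>
     (odd k \<and> even l \<longrightarrow>
        has_domination_exponent (path_graph k) (path_graph l) ((real k + 1) / real l)) \<and>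
     (k < l \<and> even k \<longrightarrow>
        has_domination_exponent (path_graph k) (path_graph l) ((real k + 1) / (real l + 1))) \<and>
     (k < l \<and> odd k \<and> odd l \<longrightarrow>
        (let a = l div (k + 1); r = l - a * (k + 1)
         in has_domination_exponent (path_graph k) (path_graph l)
              ((real k + real l - real r) / ((real a + 1) * real l))))"
proof (intro conjI impI)
  assume "k > l \<and> (even k \<or> (odd k \<and> odd l))"
  then have "real k / real l \<in> domination_exponents (path_graph k) (path_graph l)"
    using assms by (intro domination_exponentI log_path_densities.growth) auto
  then show "has_domination_exponent (path_graph k) (path_graph l) (real k / real l)"
    using exponent_ge_matching assms by (auto simp: has_domination_exponent_def)
next
  assume kl: "odd k \<and> even l"
  then have "(real k + 1) / real l \<in> domination_exponents (path_graph k) (path_graph l)"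
    using assms by (intro domination_exponentI log_path_densities.odd_even_bound) auto
  then show "has_domination_exponent (path_graph k) (path_graph l) ((real k + 1) / real l)"
    using exponent_ge_star kl assms by (auto simp: has_domination_exponent_def)
next
  assume "k < l \<and> even k"
  then have "(real k + 1) / (real l + 1) \<in> domination_exponents (path_graph k) (path_graph l)"
    using assms by (intro domination_exponentI log_path_densities.even_bound) auto
  then show "has_domination_exponent (path_graph k) (path_graph l) ((real k + 1) / (real l + 1))"
    using exponent_ge_edge assms by (auto simp: has_domination_exponent_def)
next
  assume kl: "k < l \<and> odd k \<and> odd l"
  define a where "a = l div (k + 1)"
  have "a * (k + 1) \<le> l" unfolding a_def by (rule div_times_less_eq_dividend)
  \<comment> \<open>With \<open>l - r = a * (k + 1)\<close>, the numerator \<open>k + l - r\<close>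
    equals \<open>k * (a + 1) + a\<close>.\<close>
  then have "(real k + real l - real (l - a * (k + 1))) / ((real a + 1) * real l)
      = real (k * (a + 1) + a) / real (l * (a + 1))"
    by (simp add: of_nat_diff algebra_simps)
  with odd_odd_exponent[of k l a] kl a_def
  show "let a = l div (k + 1); r = l - a * (k + 1)
    in has_domination_exponent (path_graph k) (path_graph l)
      ((real k + real l - real r) / ((real a + 1) * real l))"
    by (simp add: Let_def)
qed

end
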